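(* Suppose that $\emptyset\notin\Psi$ and let $\gamma,\delta\in(0,1)$. For each $e\in\mathcal K$ set $a_e:=|\mathcal H_{\Psi,e}^{s'_e}|$ and $b_e:=|\mathcal G_{\Psi,e}^{s'_e}|$, and let $\chi^*=(T^*,D^* )$ be the pure isolation test with thresholds $\{A_e,B_e\}_{e\in\mathcal K}$. (i) $\chi^*\in\mathcal C_\Psi(\gamma,\delta)$ when $A_e\ge a_e|\mathcal K|/\delta$ and $B_e\ge b_e|\mathcal K|/\gamma$ for all $e\in\mathcal K$. (ii) If, also, $\Psi=\Psi_{m,m}:=\{A\subseteq\mathcal K:|A|=m\}$ for some $m\in(0,|\mathcal K|)$, then $\chi^*\in\mathcal C_\Psi(\gamma,\delta)$ when $A_e\ge a_e|\mathcal K|/(\gamma\wedge\delta)$ and $B_e\ge b_e|\mathcal K|/(\gamma\wedge\delta)$ for all $e\in\mathcal K$.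
   Context: Setting. There are $K$ data sources, $[K]=\{1,\dots,K\}$; $X_n^k$ is the random element observed from source $k$ at time $n\in\mathbb N=\{1,2,\dots\}$. For $s\subseteq[K]$: $X_n^s=\{X_n^k:k\in s\}$, $X^s=\{X_n^s:n\in\mathbb N\}$, $\mathcal F_n^s=\sigma(X_1^s,\dots,X_n^s)$; the superscript is omitted when $s=[K]$. $\mathcal P$ is a finite family of distributions of $X$; $\mathsf P^s$ is the law of $X^s$ under $\mathsf P$, and $\mathcal Q^s=\{\mathsf P^s:\mathsf P\in\mathcal Q\}$ for $\mathcal Q\subseteq\mathcal P$. $\mathcal K$ is a finite family of subsets of $[K]$ (units). For each $e\in\mathcal K$, $\mathcal H^e$ (null) and $\mathcal G^e$ (alternative) are nonempty disjoint subfamilies of $\mathcal P^e$; $\mathcal A(\mathsf P)=\{e\in\mathcal K:\mathsf P^e\in\mathcal G^e\}$ is the set of signals under $\mathsf P$. $\Psi$ is a family of subsets of $\mathcal K$, and $\mathcal P_\Psi=\{\mathsf P\in\mathcal P:\mathsf P^e\in\mathcal H^e\cup\mathcal G^e\ \forall e\in\mathcal K,\ \mathcal A(\mathsf P)\in\Psi\}$, $\mathcal H_0=\{\mathsf P\in\mathcal P:\mathsf P^e\in\mathcal H^e\ \forall e\in\mathcal K\}$, $\mathcal H_{\Psi,e}=\{\mathsf P\in\mathcal P_\Psi\setminus\mathcal H_0:e\notin\mathcal A(\mathsf P)\}$, $\mathcal G_{\Psi,e}=\{\mathsf P\in\mathcal P_\Psi:e\in\mathcal A(\mathsf P)\}$.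 Standing assumption: for every $e\in\mathcal K$, $\mathsf P\in\mathcal G_{\Psi,e}\cup\mathcal H_0$, $\mathsf Q\in\mathcal H_{\Psi,e}\cup\mathcal H_0$, $e\subseteq s\subseteq[K]$, $n\in\mathbb N$, the laws $\mathsf P^s,\mathsf Q^s$ are mutually absolutely continuous on $\mathcal F_n^s$, with likelihood ratio $\Lambda_n(\mathsf P^s,\mathsf Q^s)=\frac{d\mathsf P^s}{d\mathsf Q^s}(\mathcal F_n^s)$. Isolation statistics. Each unit $e$ is assigned an isolation subsystem $s'_e$, $e\subseteq s'_e\subseteq[K]$, and $$\Lambda_{e,\rm iso}(n)=\frac{\max\{\Lambda_n(\mathsf P,\mathsf P_0'):\mathsf P\in\mathcal G_{\Psi,e}^{s'_e}\}}{\max\{\Lambda_n(\mathsf P,\mathsf P_0'):\mathsf P\in\mathcal H_{\Psi,e}^{s'_e}\}},$$ with $\mathsf P'_0\in\mathcal H_0^{s'_e}$ arbitrary (families over which maxima are taken are tacitly nonempty). $D_{\rm iso}(n)=\{e\in\mathcal K:\Lambda_{e,\rm iso}(n)>1\}$. Tests. A test is a pair $(T,D)$ with $T$ an $\{\mathcal F_n\}$-stopping time and $D$ an $\mathcal F_T$-measurable, $\Psi$-valued decision; $\mathcal C_\Psi$ is the class of all tests. $\mathcal C_\Psi(\gamma,\delta)$ is the class of $(T,D)\in\mathcal C_\Psi$ such that $\mathsf P(D\setminus\mathcal A(\mathsf P)\ne\emptyset)\le\gamma$ and $\mathsf P(\mathcal A(\mathsf P)\setminus D\neq\emptyset,\,D\ne\emptyset)\le\delta$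 for all $\mathsf P\in\mathcal P_\Psi$. Pure isolation test ($\emptyset\notin\Psi$), with thresholds $\{A_e,B_e\}$: $T^*=\inf\{n\in\mathbb N:D_{\rm iso}(n)\in\Psi,\ \Lambda_{e,\rm iso}(n)\notin(1/A_e,B_e)\ \forall e\in\mathcal K\}$, $D^*=D_{\rm iso}(T^* )$. *)

theory Defs
  imports "HOL-Probability.Probability" "HOL-Probability.Stopping_Time"
begin

text \<open>
  A path maps (time, source) to an observation. The state spaces may differ between sources; they
  share only the ambient HOL type \<open>'x\<close>. Times start at 1 and sources are numbered \<open>1, ..., K\<close>.
\<close>

type_synonym 'x path = "nat \<times> nat \<Rightarrow> 'x"

record 'x testing_problem =
  num_sources :: nat
  obs_space :: "nat \<Rightarrow> 'x measure"
  family :: "'x path measure set"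
  units :: "nat set set"
  nulls :: "nat set \<Rightarrow> 'x path measure set"
  alts :: "nat set \<Rightarrow> 'x path measure set"
  Psi :: "nat set set set"

definition sources :: "'x testing_problem \<Rightarrow> nat set" where
  "sources M = {1..num_sources M}"

definition path_space :: "'x testing_problem \<Rightarrow> nat set \<Rightarrow> 'x path measure" where
  "path_space M s = PiM ({1..} \<times> s) (\<lambda>(n, k). obs_space M k)"

definition subpath :: "nat set \<Rightarrow> 'x path \<Rightarrow> 'x path" where
  "subpath s \<omega> = restrict \<omega> ({1..} \<times> s)"

text \<open>\<open>law M s P\<close> is \<open>P\<^sup>s\<close>, a measure on the paths of the sources in \<open>s\<close> only.\<close>

definition law :: "'x testing_problem \<Rightarrow> nat set \<Rightarrow> 'x path measure \<Rightarrow> 'x path measure" where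
  "law M s P = distr P (path_space M s) (subpath s)"

definition laws :: "'x testing_problem \<Rightarrow> nat set \<Rightarrow> 'x path measure set \<Rightarrow> 'x path measure set" where
  "laws M s Q = law M s ` Q"

text \<open>
  The sigma-algebra generated by the sources in \<open>s\<close> up to time \<open>t\<close>. The index \<open>t\<close> is extended so that
  stopping times may be infinite; at \<open>t = \<infinity>\<close> this is the sigma-algebra of the whole path.
\<close>

definition filt :: "'x testing_problem \<Rightarrow> nat set \<Rightarrow> enat \<Rightarrow> 'x path measure" where
  "filt M s t =
     (let I = {i. 1 \<le> i \<and> enat i \<le> t} \<times> s
      in vimage_algebra (space (path_space M s)) (\<lambda>\<omega>. restrict \<omega> I)
           (PiM I (\<lambda>(n, k). obs_space M k)))"

text \<open>
  The library's version of \<open>dP/dQ\<close> on the time-\<open>n\<close> sigma-algebra, for \<open>P\<close> and \<open>Q\<close> laws on the paths of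
  \<open>s\<close>. It is \<open>ennreal\<close>-valued; it is strictly between \<open>0\<close> and \<open>\<infinity>\<close> off a null set when the restrictions
  of \<open>P\<close> and \<open>Q\<close> are mutually absolutely continuous.
\<close>

definition lik_ratio ::
  "'x testing_problem \<Rightarrow> nat set \<Rightarrow> nat \<Rightarrow> 'x path measure \<Rightarrow> 'x path measure \<Rightarrow> 'x path \<Rightarrow> ennreal" where
  "lik_ratio M s n P Q =
     RN_deriv (restr_to_subalg Q (filt M s (enat n))) (restr_to_subalg P (filt M s (enat n)))"

definition signals :: "'x testing_problem \<Rightarrow> 'x path measure \<Rightarrow> nat set set" where
  "signals M P = {e \<in> units M. law M e P \<in> alts M e}"

definition P_Psi :: "'x testing_problem \<Rightarrow> 'x path measure set" where
  "P_Psi M = {P \<in> family M. (\<forall>e\<in>units M. law M e P \<in> nulls M e \<union> alts M e) \<and> signals M P \<in> Psi M}"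

definition H_0 :: "'x testing_problem \<Rightarrow> 'x path measure set" where
  "H_0 M = {P \<in> family M. \<forall>e\<in>units M. law M e P \<in> nulls M e}"

definition H_Psi :: "'x testing_problem \<Rightarrow> nat set \<Rightarrow> 'x path measure set" where
  "H_Psi M e = {P \<in> P_Psi M - H_0 M. e \<notin> signals M P}"

definition G_Psi :: "'x testing_problem \<Rightarrow> nat set \<Rightarrow> 'x path measure set" where
  "G_Psi M e = {P \<in> P_Psi M. e \<in> signals M P}"

definition valid_problem :: "'x testing_problem \<Rightarrow> bool" where
  "valid_problem M \<longleftrightarrow>
     finite (family M) \<and>
     (\<forall>P\<in>family M. prob_space P \<and> sets P = sets (path_space M (sources M))) \<and>
     (\<forall>e\<in>units M. e \<subseteq> sources M) \<and>
     (\<forall>e\<in>units M.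
        nulls M e \<subseteq> laws M e (family M) \<and> nulls M e \<noteq> {} \<and>
        alts M e \<subseteq> laws M e (family M) \<and> alts M e \<noteq> {} \<and>
        nulls M e \<inter> alts M e = {}) \<and>
     (\<forall>A\<in>Psi M. A \<subseteq> units M)"

definition mutually_ac :: "'x testing_problem \<Rightarrow> bool" where
  "mutually_ac M \<longleftrightarrow>
     (\<forall>e\<in>units M. \<forall>P \<in> G_Psi M e \<union> H_0 M. \<forall>Q \<in> H_Psi M e \<union> H_0 M.
      \<forall>s n. e \<subseteq> s \<and> s \<subseteq> sources M \<and> 1 \<le> n \<longrightarrow>
        absolutely_continuous
          (restr_to_subalg (law M s P) (filt M s (enat n)))
          (restr_to_subalg (law M s Q) (filt M s (enat n))) \<and>
        absolutely_continuous
          (restr_to_subalg (law M s Q) (filt M s (enat n)))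
          (restr_to_subalg (law M s P) (filt M s (enat n))))"

text \<open>
  Stopping times take values in \<open>{1, 2, ..., \<infinity>}\<close>. Nothing is decided on \<open>T = \<infinity>\<close>, so membership of the
  decision in \<open>Psi\<close> is required on \<open>T < \<infinity>\<close> only, and the error events are sub-events of \<open>T < \<infinity>\<close>.
\<close>

type_synonym 'x test = "('x path \<Rightarrow> enat) \<times> ('x path \<Rightarrow> nat set set)"

definition tests :: "'x testing_problem \<Rightarrow> 'x test set" where
  "tests M =
     {(T, D).
        stopping_time (filt M (sources M)) T \<and>
        (\<forall>\<omega>\<in>space (path_space M (sources M)). 1 \<le> T \<omega>) \<and>
        D \<in> filtration.pre_sigma (space (path_space M (sources M))) (filt M (sources M)) T
              \<rightarrow>\<^sub>M count_space (Pow (units M)) \<and>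
        (\<forall>\<omega>\<in>space (path_space M (sources M)). T \<omega> < \<infinity> \<longrightarrow> D \<omega> \<in> Psi M)}"

definition controlled_tests :: "'x testing_problem \<Rightarrow> real \<Rightarrow> real \<Rightarrow> 'x test set" where
  "controlled_tests M \<gamma> \<delta> =
     {(T, D). (T, D) \<in> tests M \<and>
        (\<forall>P\<in>P_Psi M.
           measure P {\<omega> \<in> space P. T \<omega> < \<infinity> \<and> D \<omega> - signals M P \<noteq> {}} \<le> \<gamma> \<and>
           measure P {\<omega> \<in> space P. T \<omega> < \<infinity> \<and> signals M P - D \<omega> \<noteq> {} \<and> D \<omega> \<noteq> {}} \<le> \<delta>)}"

text \<open>
  \<open>sub e\<close> is the isolation subsystem of the unit \<open>e\<close>, and \<open>P0 e\<close> is its reference law, an element of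
  \<open>laws M (sub e) (H_0 M)\<close>.
\<close>

definition iso_stat ::
  "'x testing_problem \<Rightarrow> (nat set \<Rightarrow> nat set) \<Rightarrow> (nat set \<Rightarrow> 'x path measure) \<Rightarrow>
   nat set \<Rightarrow> nat \<Rightarrow> 'x path \<Rightarrow> ennreal" where
  "iso_stat M sub P0 e n \<omega> =
     Max ((\<lambda>P. lik_ratio M (sub e) n P (P0 e) (subpath (sub e) \<omega>)) ` laws M (sub e) (G_Psi M e)) /
     Max ((\<lambda>P. lik_ratio M (sub e) n P (P0 e) (subpath (sub e) \<omega>)) ` laws M (sub e) (H_Psi M e))"

definition D_iso ::
  "'x testing_problem \<Rightarrow> (nat set \<Rightarrow> nat set) \<Rightarrow> (nat set \<Rightarrow> 'x path measure) \<Rightarrow>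
   nat \<Rightarrow> 'x path \<Rightarrow> nat set set" where
  "D_iso M sub P0 n \<omega> = {e \<in> units M. iso_stat M sub P0 e n \<omega> > 1}"

definition T_star ::
  "'x testing_problem \<Rightarrow> (nat set \<Rightarrow> nat set) \<Rightarrow> (nat set \<Rightarrow> 'x path measure) \<Rightarrow>
   (nat set \<Rightarrow> real) \<Rightarrow> (nat set \<Rightarrow> real) \<Rightarrow> 'x path \<Rightarrow> enat" where
  "T_star M sub P0 A B \<omega> =
     Inf (enat ` {n. 1 \<le> n \<and> D_iso M sub P0 n \<omega> \<in> Psi M \<and>
       (\<forall>e\<in>units M. iso_stat M sub P0 e n \<omega> \<notin> {ennreal (1 / A e)<..<ennreal (B e)})})"

text \<open>The value \<open>{}\<close> on \<open>T_star = \<infinity>\<close> is a dummy.\<close>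

definition D_star ::
  "'x testing_problem \<Rightarrow> (nat set \<Rightarrow> nat set) \<Rightarrow> (nat set \<Rightarrow> 'x path measure) \<Rightarrow>
   (nat set \<Rightarrow> real) \<Rightarrow> (nat set \<Rightarrow> real) \<Rightarrow> 'x path \<Rightarrow> nat set set" where
  "D_star M sub P0 A B \<omega> =
     (case T_star M sub P0 A B \<omega> of enat n \<Rightarrow> D_iso M sub P0 n \<omega> | \<infinity> \<Rightarrow> {})"

definition pure_isolation_test ::
  "'x testing_problem \<Rightarrow> (nat set \<Rightarrow> nat set) \<Rightarrow> (nat set \<Rightarrow> 'x path measure) \<Rightarrow>
   (nat set \<Rightarrow> real) \<Rightarrow> (nat set \<Rightarrow> real) \<Rightarrow> 'x test" where
  "pure_isolation_test M sub P0 A B = (T_star M sub P0 A B, D_star M sub P0 A B)"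

end

theory Submission
  imports Defs
begin

text \<open>
  The two error bounds are instances of one maximal inequality. Let \<open>P\<close> be the true distribution and
  suppose that the test wrongly declares a unit \<open>e\<close> to be a signal when it stops. All thresholds exceed
  \<open>1\<close>, so the isolation statistic of \<open>e\<close>, being above \<open>1\<close> and outside \<open>(1/A e, B e)\<close>, is at least
  \<open>B e\<close>. As \<open>Psi\<close> does not contain the empty set, \<open>P\<close> is not in the global null, and so the law of
  \<open>P\<close> on the isolation subsystem is one of those maximised over in the denominator. Therefore at that
  time some law \<open>Q\<close> of the numerator has likelihood at least \<open>B e\<close> times the likelihood of \<open>P\<close>. By Ville's
  inequality (\<open>likelihood_ratio_maximal_inequality\<close>) this happens at some time with \<open>P\<close>-probability at
  most \<open>1 / B e\<close>. Summing over the \<open>b e\<close> laws \<open>Q\<close> (\<open>crossing_bound\<close>) and then over the units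
  (\<open>union_bound\<close>) gives the level \<open>\<gamma>\<close>. A signal \<open>e\<close> that is wrongly left out is treated in the same way
  with numerator and denominator exchanged, \<open>A e\<close> in place of \<open>B e\<close>, and level \<open>\<delta>\<close>. For the second
  part, the prescribed thresholds dominate those of the first.

  The reference law is a common dominating measure for the laws that are compared.
  The remaining work is measurability: every isolation statistic is adapted to the filtration of the
  whole system, which makes the pair \<open>(T_star, D_star)\<close> a test (\<open>pure_isolation_test_in_tests\<close>).
\<close>

section \<open>A maximal inequality for likelihood ratios\<close>

lemma emeasure_RN_deriv_subalg:
  assumes R: "prob_space R" and sub: "subalgebra R F" and PR: "sets P = sets R"
    and ac: "absolutely_continuous (restr_to_subalg R F) (restr_to_subalg P F)"
    and A: "A \<in> sets F"
  shows "emeasure P A =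
    (\<integral>\<^sup>+x\<in>A. RN_deriv (restr_to_subalg R F) (restr_to_subalg P F) x \<partial>restr_to_subalg R F)"
proof -
  let ?R = "restr_to_subalg R F" and ?P = "restr_to_subalg P F"
  have subP: "subalgebra P F"
    using sub PR sets_eq_imp_space_eq[OF PR] by (simp add: subalgebra_def)
  interpret R: prob_space ?R
    by (rule prob_space_restr_to_subalg[OF sub R])
  have [simp]: "sets ?P = sets F" "sets ?R = sets F"
    using subP sub by (simp_all add: sets_restr_to_subalg)
  have "emeasure P A = emeasure ?P A"
    by (simp add: emeasure_restr_to_subalg[OF subP A])
  also have "?P = density ?R (RN_deriv ?R ?P)"
    using R.density_RN_deriv[OF ac] by simp
  also have "emeasure \<dots> A = (\<integral>\<^sup>+x\<in>A. RN_deriv ?R ?P x \<partial>?R)"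
    by (rule emeasure_density) (use A in auto)
  finally show ?thesis .
qed

text \<open>
  This is Ville's inequality for the likelihood ratio of \<open>Q\<close> against \<open>P\<close>, with both densities taken
  with respect to a common reference \<open>R\<close>. At the first time \<open>n\<close> at which
  \<open>c * dP/dR \<le> dQ/dR\<close>, integrating this inequality over the \<open>F n\<close>-measurable first-crossing event
  shows that \<open>P\<close> gives that event at most \<open>1/c\<close> times its \<open>Q\<close>-probability, and the first-crossing
  events are disjoint. Stating the crossing as a product avoids every \<open>0/0\<close> and \<open>\<infinity>/\<infinity>\<close>.
\<close>

lemma likelihood_ratio_maximal_inequality:
  fixes F :: "nat \<Rightarrow> 'a measure"
  assumes R: "prob_space R" and Q: "prob_space Q"
    and PR: "sets P = sets R" and QR: "sets Q = sets R"
    and sub: "\<And>n. subalgebra R (F n)"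
    and mono: "\<And>m n. m \<le> n \<Longrightarrow> sets (F m) \<subseteq> sets (F n)"
    and acP: "\<And>n. absolutely_continuous (restr_to_subalg R (F n)) (restr_to_subalg P (F n))"
    and acQ: "\<And>n. absolutely_continuous (restr_to_subalg R (F n)) (restr_to_subalg Q (F n))"
  defines "p \<equiv> \<lambda>n. RN_deriv (restr_to_subalg R (F n)) (restr_to_subalg P (F n))"
    and "q \<equiv> \<lambda>n. RN_deriv (restr_to_subalg R (F n)) (restr_to_subalg Q (F n))"
  shows "c * emeasure P {x \<in> space R. \<exists>n. c * p n x \<le> q n x} \<le> 1"
proof -
  define E where "E n = {x \<in> space R. c * p n x \<le> q n x}" for n
  have spF: "space (F n) = space R" for n
    using sub[of n] by (simp add: subalgebra_def)
  have meas: "p n \<in> borel_measurable (F n)" "q n \<in> borel_measurable (F n)" for n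
    unfolding p_def q_def using measurable_in_subalg'[OF sub borel_measurable_RN_deriv] by auto
  have E: "E n \<in> sets (F n)" for n
  proof -
    note meas[of n, measurable]
    have "{x \<in> space (F n). c * p n x \<le> q n x} \<in> sets (F n)" by measurable
    then show ?thesis by (simp add: E_def spF)
  qed
  have first: "disjointed E n \<in> sets (F n)" for n
    unfolding disjointed_def using E mono by (intro sets.Diff sets.finite_UN) (auto, meson less_imp_le subsetD)
  have firstR: "disjointed E n \<in> sets R" for n
    using first sub by (auto simp: subalgebra_def)
  have step: "c * emeasure P (disjointed E n) \<le> emeasure Q (disjointed E n)" for n
  proof -
    let ?A = "disjointed E n" and ?R = "restr_to_subalg R (F n)"
    have [measurable]: "p n \<in> borel_measurable ?R" "?A \<in> sets ?R"
      using first[of n] by (auto simp: p_def sets_restr_to_subalg[OF sub])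
    have "c * emeasure P ?A = c * (\<integral>\<^sup>+x\<in>?A. p n x \<partial>?R)"
      unfolding p_def by (subst emeasure_RN_deriv_subalg[OF R sub PR acP first]) simp
    also have "\<dots> = (\<integral>\<^sup>+x. c * (p n x * indicator ?A x) \<partial>?R)"
      by (rule nn_integral_cmult[symmetric]) measurable
    also have "\<dots> \<le> (\<integral>\<^sup>+x\<in>?A. q n x \<partial>?R)"
      using disjointed_subset[of E n]
      by (intro nn_integral_mono) (auto simp: E_def split: split_indicator)
    also have "\<dots> = emeasure Q ?A"
      unfolding q_def by (subst emeasure_RN_deriv_subalg[OF R sub QR acQ first]) simp
    finally show ?thesis .
  qed
  have "c * emeasure P {x \<in> space R. \<exists>n. c * p n x \<le> q n x} = c * emeasure P (\<Union>n. disjointed E n)"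
    unfolding UN_disjointed_eq by (auto simp: E_def intro!: arg_cong[where f="\<lambda>A. c * emeasure P A"])
  also have "\<dots> = (\<Sum>n. c * emeasure P (disjointed E n))"
    using firstR disjoint_family_disjointed[of E]
    by (subst suminf_emeasure[symmetric]) (auto simp: PR)
  also have "\<dots> \<le> (\<Sum>n. emeasure Q (disjointed E n))"
    by (intro suminf_le step) auto
  also have "\<dots> = emeasure Q (\<Union>n. disjointed E n)"
    using firstR disjoint_family_disjointed[of E] by (intro suminf_emeasure) (auto simp: QR)
  also have "\<dots> \<le> 1"
    by (rule prob_space.emeasure_le_1[OF Q])
  finally show ?thesis .
qed

section \<open>Measurability of subsystem statistics\<close>

lemma restrict_measurable_path_space:
  "I \<subseteq> {1..} \<times> s \<Longrightarrow>
    (\<lambda>\<omega>. restrict \<omega> I) \<in> path_space M s \<rightarrow>\<^sub>M PiM I (\<lambda>(n, k). obs_space M k)"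
  unfolding path_space_def by (rule measurable_restrict_subset)

lemma space_filt [simp]: "space (filt M s t) = space (path_space M s)"
  by (simp add: filt_def Let_def)

text \<open>
  Everything observed from the sources in \<open>s\<close> up to time \<open>t\<close> is measurable for \<open>filt M s t\<close>, in
  particular what is observed over a shorter horizon or from fewer sources.
\<close>

lemma restrict_measurable_filt:
  assumes "J \<subseteq> {i. 1 \<le> i \<and> enat i \<le> t} \<times> s"
  shows "(\<lambda>\<omega>. restrict \<omega> J) \<in> filt M s t \<rightarrow>\<^sub>M PiM J (\<lambda>(n, k). obs_space M k)"
proof -
  let ?I = "{i. 1 \<le> i \<and> enat i \<le> t} \<times> s"
  have "(\<lambda>\<omega>. restrict \<omega> ?I) \<in> filt M s t \<rightarrow>\<^sub>M PiM ?I (\<lambda>(n, k). obs_space M k)"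
    unfolding filt_def Let_def
    by (rule measurable_vimage_algebra1, rule Pi_I,
        rule measurable_space[OF restrict_measurable_path_space]) auto
  from measurable_compose[OF this measurable_restrict_subset[OF assms]]
  show ?thesis
    using assms by (simp add: Int_absorb1)
qed

lemma measurable_into_filt:
  assumes "g \<in> space N \<rightarrow> space (path_space M s)"
    and "(\<lambda>\<omega>. restrict (g \<omega>) ({i. 1 \<le> i \<and> enat i \<le> t} \<times> s)) \<in>
      N \<rightarrow>\<^sub>M PiM ({i. 1 \<le> i \<and> enat i \<le> t} \<times> s) (\<lambda>(n, k). obs_space M k)"
  shows "g \<in> N \<rightarrow>\<^sub>M filt M s t"
  unfolding filt_def Let_def by (rule measurable_vimage_algebra2[where f="\<lambda>\<omega>. restrict \<omega> _", OF assms])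

lemma subalgebra_filt: "subalgebra (path_space M s) (filt M s t)"
proof -
  have "(\<lambda>\<omega>. \<omega>) \<in> path_space M s \<rightarrow>\<^sub>M filt M s t"
    by (rule measurable_into_filt) (auto intro!: restrict_measurable_path_space)
  from measurable_sets[OF this] show ?thesis
    unfolding subalgebra_def using sets.sets_into_space[of _ "filt M s t"]
    by (auto simp: vimage_def Int_absorb2)
qed

lemma sets_filt_mono: "t \<le> u \<Longrightarrow> sets (filt M s t) \<subseteq> sets (filt M s u)"
proof -
  assume "t \<le> u"
  then have "(\<lambda>\<omega>. \<omega>) \<in> filt M s u \<rightarrow>\<^sub>M filt M s t"
    by (intro measurable_into_filt restrict_measurable_filt) (auto intro: order_trans)
  from measurable_sets[OF this] show ?thesis
    using sets.sets_into_space[of _ "filt M s t"] by (auto simp: vimage_def Int_absorb2)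
qed

lemma filtration_filt: "filtration (space (path_space M s)) (filt M s)"
  by unfold_locales (auto intro: sets_filt_mono[THEN subsetD])

lemma subpath_measurable:
  "s \<subseteq> s' \<Longrightarrow> subpath s \<in> path_space M s' \<rightarrow>\<^sub>M path_space M s"
  unfolding path_space_def subpath_def by (rule measurable_restrict_subset) auto

lemma subpath_measurable_filt:
  assumes "s \<subseteq> s'"
  shows "subpath s \<in> filt M s' t \<rightarrow>\<^sub>M filt M s t"
proof (rule measurable_into_filt)
  show "subpath s \<in> space (filt M s' t) \<rightarrow> space (path_space M s)"
    using measurable_space[OF subpath_measurable[OF assms]] by auto
  have "({1..} \<times> s) \<inter> ({i. 1 \<le> i \<and> enat i \<le> t} \<times> s) = {i. 1 \<le> i \<and> enat i \<le> t} \<times> s"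
    by auto
  then show "(\<lambda>\<omega>. restrict (subpath s \<omega>) ({i. 1 \<le> i \<and> enat i \<le> t} \<times> s))
    \<in> filt M s' t \<rightarrow>\<^sub>M PiM ({i. 1 \<le> i \<and> enat i \<le> t} \<times> s) (\<lambda>(n, k). obs_space M k)"
    unfolding subpath_def using assms
    by (simp only: restrict_restrict) (intro restrict_measurable_filt, auto)
qed

lemma lik_ratio_measurable:
  assumes "sets Q = sets (path_space M s)"
  shows "lik_ratio M s n P Q \<in> borel_measurable (filt M s (enat n))"
proof -
  have "subalgebra Q (filt M s (enat n))"
    using subalgebra_filt[of M s] assms sets_eq_imp_space_eq[OF assms]
    by (simp add: subalgebra_def)
  then show ?thesis
    unfolding lik_ratio_def by (rule measurable_in_subalg'[OF _ borel_measurable_RN_deriv])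
qed

lemma sets_law [simp]: "sets (law M s P) = sets (path_space M s)"
  by (simp add: law_def)

lemma prob_space_law:
  assumes "valid_problem M" "P \<in> family M" "s \<subseteq> sources M"
  shows "prob_space (law M s P)"
proof -
  have P: "prob_space P" and sP: "sets P = sets (path_space M (sources M))"
    using assms by (auto simp: valid_problem_def)
  have "subpath s \<in> P \<rightarrow>\<^sub>M path_space M s"
    using subpath_measurable[OF assms(3)] measurable_cong_sets[OF sP refl] by blast
  with P show ?thesis
    unfolding law_def by (rule prob_space.prob_space_distr)
qed

lemma finite_laws:
  assumes "valid_problem M"
  shows "finite (laws M s (G_Psi M e))" "finite (laws M s (H_Psi M e))"
proof -
  have "G_Psi M e \<subseteq> family M" "H_Psi M e \<subseteq> family M" "finite (family M)"
    using assms by (auto simp: G_Psi_def H_Psi_def P_Psi_def valid_problem_def)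
  then show "finite (laws M s (G_Psi M e))" "finite (laws M s (H_Psi M e))"
    by (auto simp: laws_def intro: finite_subset)
qed

lemma finite_units:
  assumes "valid_problem M"
  shows "finite (units M)"
proof (rule finite_subset)
  show "units M \<subseteq> Pow (sources M)"
    using assms by (auto simp: valid_problem_def)
  show "finite (Pow (sources M))"
    by (simp add: sources_def)
qed

lemma iso_stat_measurable:
  assumes "valid_problem M" "sub e \<subseteq> sources M" "P0 e \<in> laws M (sub e) (H_0 M)"
  shows "iso_stat M sub P0 e n \<in> borel_measurable (filt M (sources M) (enat n))"
proof -
  have "sets (P0 e) = sets (path_space M (sub e))"
    using assms(3) by (auto simp: laws_def)
  then have [measurable]: "(\<lambda>\<omega>. lik_ratio M (sub e) n P (P0 e) (subpath (sub e) \<omega>))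
      \<in> borel_measurable (filt M (sources M) (enat n))" for P
    by (intro measurable_compose[OF subpath_measurable_filt[OF assms(2)]] lik_ratio_measurable)
  show ?thesis
    unfolding iso_stat_def[abs_def]
    by (intro borel_measurable_divide_ennreal borel_measurable_Max finite_laws assms(1)) measurable
qed

section \<open>Measurability of the pure isolation test\<close>

text \<open>
  The set \<open>D_iso\<close> at time \<open>n\<close> is fixed by finitely many comparisons of isolation statistics with
  \<open>1\<close>, and each statistic depends on its own subsystem up to time \<open>n\<close>.
\<close>

lemma D_iso_eq_measurable:
  assumes "valid_problem M"
    and "\<forall>e\<in>units M. sub e \<subseteq> sources M" "\<forall>e\<in>units M. P0 e \<in> laws M (sub e) (H_0 M)"
  shows "Measurable.pred (filt M (sources M) (enat n)) (\<lambda>\<omega>. D_iso M sub P0 n \<omega> = d)"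
proof (cases "d \<subseteq> units M")
  case True
  then have eq: "D_iso M sub P0 n \<omega> = d \<longleftrightarrow> (\<forall>e\<in>units M. (1 < iso_stat M sub P0 e n \<omega>) = (e \<in> d))" for \<omega>
    unfolding D_iso_def by auto
  show ?thesis
    unfolding eq
  proof (intro pred_intros_finite finite_units[OF assms(1)])
    fix e assume "e \<in> units M"
    then have [measurable]: "iso_stat M sub P0 e n \<in> borel_measurable (filt M (sources M) (enat n))"
      using assms by (intro iso_stat_measurable) auto
    show "Measurable.pred (filt M (sources M) (enat n)) (\<lambda>\<omega>. (1 < iso_stat M sub P0 e n \<omega>) = (e \<in> d))"
      by measurable
  qed
next
  case False
  then have "(\<lambda>\<omega>. D_iso M sub P0 n \<omega> = d) = (\<lambda>\<omega>. False)"
    by (auto simp: D_iso_def fun_eq_iff)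
  then show ?thesis by simp
qed

definition stops_at ::
  "'x testing_problem \<Rightarrow> (nat set \<Rightarrow> nat set) \<Rightarrow> (nat set \<Rightarrow> 'x path measure) \<Rightarrow>
   (nat set \<Rightarrow> real) \<Rightarrow> (nat set \<Rightarrow> real) \<Rightarrow> nat \<Rightarrow> 'x path \<Rightarrow> bool" where
  "stops_at M sub P0 A B n \<omega> \<longleftrightarrow> 1 \<le> n \<and> D_iso M sub P0 n \<omega> \<in> Psi M \<and>
     (\<forall>e\<in>units M. iso_stat M sub P0 e n \<omega> \<notin> {ennreal (1 / A e)<..<ennreal (B e)})"

lemma T_star_eq_Inf: "T_star M sub P0 A B \<omega> = Inf (enat ` {n. stops_at M sub P0 A B n \<omega>})"
  by (simp add: T_star_def stops_at_def)

lemma T_star_attained: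
  assumes "T_star M sub P0 A B \<omega> = enat n"
  shows "stops_at M sub P0 A B n \<omega>"
proof -
  let ?S = "enat ` {n. stops_at M sub P0 A B n \<omega>}"
  have "?S \<noteq> {}"
    using assms unfolding T_star_eq_Inf by (auto simp: Inf_enat_def split: if_splits)
  then have "Inf ?S \<in> ?S"
    unfolding Inf_enat_def by (auto intro: LeastI)
  then show ?thesis
    using assms unfolding T_star_eq_Inf by auto
qed

lemma stops_at_measurable:
  assumes "valid_problem M"
    and "\<forall>e\<in>units M. sub e \<subseteq> sources M" "\<forall>e\<in>units M. P0 e \<in> laws M (sub e) (H_0 M)"
  shows "Measurable.pred (filt M (sources M) (enat n)) (stops_at M sub P0 A B n)"
proof -
  let ?F = "filt M (sources M) (enat n)"
  have "finite (Psi M)"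
    using assms(1) finite_units[OF assms(1)]
    by (intro finite_subset[of "Psi M" "Pow (units M)"]) (auto simp: valid_problem_def)
  then have 1: "Measurable.pred ?F (\<lambda>\<omega>. \<exists>d\<in>Psi M. D_iso M sub P0 n \<omega> = d)"
    by (intro pred_intros_finite D_iso_eq_measurable assms)
  have 2: "Measurable.pred ?F
      (\<lambda>\<omega>. \<forall>e\<in>units M. iso_stat M sub P0 e n \<omega> \<notin> {ennreal (1 / A e)<..<ennreal (B e)})"
  proof (intro pred_intros_finite finite_units[OF assms(1)])
    fix e assume "e \<in> units M"
    then have [measurable]: "iso_stat M sub P0 e n \<in> borel_measurable ?F"
      using assms by (intro iso_stat_measurable) auto
    show "Measurable.pred ?F (\<lambda>\<omega>. iso_stat M sub P0 e n \<omega> \<notin> {ennreal (1 / A e)<..<ennreal (B e)})"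
      by measurable
  qed
  have "stops_at M sub P0 A B n = (\<lambda>\<omega>. 1 \<le> n \<and> (\<exists>d\<in>Psi M. D_iso M sub P0 n \<omega> = d) \<and>
     (\<forall>e\<in>units M. iso_stat M sub P0 e n \<omega> \<notin> {ennreal (1 / A e)<..<ennreal (B e)}))"
    by (auto simp: stops_at_def fun_eq_iff)
  then show ?thesis
    using 1 2 by simp
qed

text \<open>
  \<open>T_star\<close> is the first hitting time of an adapted sequence of events. Its decision is determined by
  \<open>T_star\<close> and the values of \<open>D_iso\<close> at finite times, so each event \<open>D_star = d\<close> splits into countably
  many pieces according to the value of \<open>T_star\<close>.
\<close>

lemma pure_isolation_test_in_tests:
  assumes "valid_problem M"
    and "\<forall>e\<in>units M. sub e \<subseteq> sources M" "\<forall>e\<in>units M. P0 e \<in> laws M (sub e) (H_0 M)"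
  shows "pure_isolation_test M sub P0 A B \<in> tests M"
proof -
  let ?\<Omega> = "space (path_space M (sources M))" and ?F = "filt M (sources M)"
  let ?T = "T_star M sub P0 A B" and ?D = "D_star M sub P0 A B"
  interpret filtration ?\<Omega> ?F
    by (rule filtration_filt)
  have stop: "stopping_time ?F ?T"
  proof -
    define S where "S i \<omega> = (case i of enat n \<Rightarrow> stops_at M sub P0 A B n \<omega> | \<infinity> \<Rightarrow> False)" for i \<omega>
    have "Measurable.pred (?F i) (S i)" for i
      using stops_at_measurable[OF assms] by (cases i) (simp_all add: S_def[abs_def])
    then have "stopping_time ?F (\<lambda>\<omega>. Inf {i. S i \<omega>})"
      by (rule stopping_time_Inf_enat[OF filtration_filt])
    moreover have "{i. S i \<omega>} = enat ` {n. stops_at M sub P0 A B n \<omega>}" for \<omega>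
      by (auto simp: S_def split: enat.splits)
    ultimately show ?thesis
      by (simp add: T_star_eq_Inf[abs_def])
  qed
  have ge1: "1 \<le> ?T \<omega>" for \<omega>
    unfolding T_star_eq_Inf by (rule Inf_greatest) (auto simp: stops_at_def one_enat_def)
  have Psi: "?D \<omega> \<in> Psi M" if "?T \<omega> < \<infinity>" for \<omega>
    using that T_star_attained[of M sub P0 A B \<omega>]
    by (cases "?T \<omega>") (auto simp: D_star_def stops_at_def)
  have dec: "?D \<in> pre_sigma ?T \<rightarrow>\<^sub>M count_space (Pow (units M))"
  proof (subst measurable_count_space_eq2, use finite_units[OF assms(1)] in simp, intro conjI ballI)
    show "?D \<in> space (pre_sigma ?T) \<rightarrow> Pow (units M)"
      by (auto simp: D_star_def D_iso_def split: enat.splits)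
    fix d
    have "Measurable.pred (pre_sigma ?T) (\<lambda>\<omega>. ?D \<omega> = d)"
    proof (rule pred_pre_sigmaI[OF stop])
      fix t
      have at: "Measurable.pred (?F t) (\<lambda>\<omega>. ?T \<omega> = enat n \<and> D_iso M sub P0 n \<omega> = d)"
        if "enat n \<le> t" for n
      proof -
        have "Measurable.pred (?F (enat n)) (\<lambda>\<omega>. ?T \<omega> = enat n \<and> D_iso M sub P0 n \<omega> = d)"
          by (intro pred_intros_logic stopping_time_eq_const stop D_iso_eq_measurable assms)
        then show ?thesis
          using sets_filt_mono[OF that] by (auto simp: pred_def)
      qed
      have eq: "(?D \<omega> = d \<and> ?T \<omega> \<le> t) \<longleftrightarrow>
          (\<exists>n\<in>{n. enat n \<le> t}. ?T \<omega> = enat n \<and> D_iso M sub P0 n \<omega> = d)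
          \<or> (t = \<infinity> \<and> d = {} \<and> ?T \<omega> = t)" for \<omega>
        \<comment> \<open>The last disjunct is the dummy decision on paths that never stop.\<close>
        by (cases "?T \<omega>"; cases t) (auto simp: D_star_def)
      show "Measurable.pred (?F t) (\<lambda>\<omega>. ?D \<omega> = d \<and> ?T \<omega> \<le> t)"
        unfolding eq
        by (intro pred_intros_logic pred_intros_countable_bounded at stopping_time_eq_const stop) auto
    qed
    then show "?D -` {d} \<inter> space (pre_sigma ?T) \<in> sets (pre_sigma ?T)"
      by (simp add: pred_def vimage_def Int_def conj_commute)
  qed
  show ?thesis
    unfolding pure_isolation_test_def tests_def using stop ge1 dec Psi by auto
qed

section \<open>Error probabilities\<close>

text \<open>
  The next two lemmas turn a statement about a ratio of maxima into one about products. They hold for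
  all extended values because of how the degenerate ratios are defined: \<open>a / \<infinity> = 0\<close>, \<open>0 / 0 = 0\<close>, and
  \<open>a / 0 = \<infinity>\<close> for \<open>a > 0\<close>. Hence the error events are contained in crossing events for every
  path, including those on which a likelihood ratio degenerates.
\<close>

lemma threshold_le_divide_imp_mult_le:
  fixes a b c :: ennreal
  assumes "c \<le> a / b"
  shows "c * b \<le> a"
proof (cases "b = 0 \<or> b = \<infinity>")
  case True
  then show ?thesis using assms by auto
next
  case False
  then have "c * b \<le> a / b * b"
    using assms by (intro mult_right_mono) auto
  then show ?thesis
    using False by (simp add: ennreal_divide_times less_top[symmetric] zero_less_iff_neq_zero)
qed

text \<open>
  The hypothesis bounds the ratio by a finite number, which excludes \<open>a / 0\<close> with \<open>a > 0\<close>.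
\<close>

lemma divide_le_inverse_threshold_imp_mult_le:
  fixes a b :: ennreal
  assumes "a / b \<le> ennreal (1 / c)" "0 < c"
  shows "ennreal c * a \<le> b"
proof (cases "b = 0 \<or> b = \<infinity>")
  case True
  then show ?thesis using assms by (auto split: if_splits simp: top_unique)
next
  case False
  have "ennreal c * a = ennreal c * (a / b * b)"
    using False by (simp add: ennreal_divide_times less_top[symmetric] zero_less_iff_neq_zero)
  also have "\<dots> \<le> ennreal c * (ennreal (1 / c) * b)"
    using assms by (intro mult_left_mono mult_right_mono) auto
  also have "\<dots> = b"
    using assms(2) by (simp add: mult.assoc[symmetric] ennreal_mult[symmetric])
  finally show ?thesis .
qed

text \<open>
  The event that the likelihood ratio of some \<open>Q\<close> in a family against \<open>P\<close> ever reaches \<open>c\<close>, written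
  with densities relative to \<open>R\<close>. Here \<open>P\<close>, \<open>R\<close> and the family are laws on the subsystem \<open>s\<close>, but the
  event lives on the paths of the whole system, so that events for different subsystems can be united.
\<close>

definition crossing ::
  "'x testing_problem \<Rightarrow> nat set \<Rightarrow> 'x path measure \<Rightarrow> real \<Rightarrow> 'x path measure \<Rightarrow>
   'x path measure set \<Rightarrow> 'x path set" where
  "crossing M s R c P \<Q> = {\<omega> \<in> space (path_space M (sources M)). \<exists>n\<ge>1. \<exists>Q\<in>\<Q>.
     ennreal c * lik_ratio M s n P R (subpath s \<omega>) \<le> lik_ratio M s n Q R (subpath s \<omega>)}"

text \<open>
  The maximal inequality applied to each alternative law, with a union bound over the laws. Distinct
  members of \<open>\<Q>\<close> with the same law on \<open>s\<close> give the same crossing event, so the laws are counted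
  rather than the distributions; this is where \<open>a_e\<close> and \<open>b_e\<close> come from.
\<close>

lemma crossing_bound:
  assumes M: "valid_problem M" and s: "s \<subseteq> sources M"
    and fam: "P \<in> family M" "R \<in> family M" "\<Q> \<subseteq> family M" and c: "0 < c"
    and ac: "\<And>Q n. Q \<in> insert P \<Q> \<Longrightarrow> 1 \<le> n \<Longrightarrow>
      absolutely_continuous (restr_to_subalg (law M s R) (filt M s (enat n)))
                            (restr_to_subalg (law M s Q) (filt M s (enat n)))"
  shows "crossing M s (law M s R) c (law M s P) (laws M s \<Q>) \<in> sets P"
    and "measure P (crossing M s (law M s R) c (law M s P) (laws M s \<Q>)) \<le> card (laws M s \<Q>) / c"
proof -
  let ?R = "law M s R" and ?P = "law M s P"
  define E where "E Q = {x \<in> space ?R. \<exists>n. ennreal c * lik_ratio M s (Suc n) ?P ?R x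
      \<le> lik_ratio M s (Suc n) Q ?R x}" for Q
  have sP: "sets P = sets (path_space M (sources M))" and pP: "prob_space P"
    using M fam by (auto simp: valid_problem_def)
  have spP: "space P = space (path_space M (sources M))"
    by (rule sets_eq_imp_space_eq[OF sP])
  have spR: "space ?R = space (path_space M s)"
    by (simp add: law_def)
  have proj: "subpath s \<in> P \<rightarrow>\<^sub>M path_space M s"
    using subpath_measurable[OF s] measurable_cong_sets[OF sP refl] by blast
  have fin: "finite (laws M s \<Q>)"
    using fam M by (auto simp: laws_def valid_problem_def intro: finite_subset)
  have lik: "lik_ratio M s n Q ?R \<in> borel_measurable (path_space M s)" for n Q
    by (rule measurable_from_subalg[OF subalgebra_filt lik_ratio_measurable]) simp
  have E: "E Q \<in> sets (path_space M s)" for Q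
  proof -
    have "Measurable.pred N (\<lambda>x. ennreal c * f x \<le> g x)"
      if [measurable]: "f \<in> borel_measurable N" "g \<in> borel_measurable N" for N f g
      by measurable
    from this[OF lik lik]
    have "Measurable.pred (path_space M s)
      (\<lambda>x. \<exists>n. ennreal c * lik_ratio M s (Suc n) ?P ?R x \<le> lik_ratio M s (Suc n) Q ?R x)"
      by (rule pred_intros_countable)
    then show ?thesis
      by (simp add: E_def spR pred_def)
  qed
  \<comment> \<open>Time is shifted by one because the maximal inequality runs over all natural numbers.\<close>
  have eq: "crossing M s ?R c ?P (laws M s \<Q>) = (\<Union>Q\<in>laws M s \<Q>. subpath s -` E Q \<inter> space P)"
  proof -
    have "(\<exists>n\<ge>1. X n) \<longleftrightarrow> (\<exists>n. X (Suc n))" for X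
      by (metis One_nat_def Suc_le_D Suc_le_mono le0)
    then show ?thesis
      unfolding crossing_def E_def spP[symmetric]
      using measurable_space[OF proj] by (auto simp: spR)
  qed
  show "crossing M s ?R c ?P (laws M s \<Q>) \<in> sets P"
    unfolding eq using fin measurable_sets[OF proj E] by (intro sets.finite_UN) auto
  have each: "measure P (subpath s -` E Q \<inter> space P) \<le> 1 / c" if "Q \<in> laws M s \<Q>" for Q
  proof -
    obtain Q' where Q: "Q = law M s Q'" and Q': "Q' \<in> \<Q>"
      using \<open>Q \<in> laws M s \<Q>\<close> by (auto simp: laws_def)
    have "ennreal c * emeasure ?P (E Q) \<le> 1"
      unfolding E_def lik_ratio_def Q
    proof (rule likelihood_ratio_maximal_inequality)
      show "prob_space ?R" "prob_space (law M s Q')"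
        using Q' fam s M by (auto intro: prob_space_law)
      show "subalgebra ?R (filt M s (enat (Suc n)))" for n
        using subalgebra_filt[of M s] by (simp add: subalgebra_def law_def)
      show "sets (filt M s (enat (Suc m))) \<subseteq> sets (filt M s (enat (Suc n)))" if "m \<le> n" for m n
        using that by (intro sets_filt_mono) simp
    qed (use ac Q' in auto)
    moreover have "emeasure ?P (E Q) = ennreal (measure P (subpath s -` E Q \<inter> space P))"
      using emeasure_distr[OF proj E] pP
      by (simp add: law_def finite_measure.emeasure_eq_measure prob_space_def)
    ultimately have "c * measure P (subpath s -` E Q \<inter> space P) \<le> 1"
      using c by (simp add: ennreal_mult'[symmetric])
    then show ?thesis
      using c by (simp add: field_simps)
  qed
  have "measure P (crossing M s ?R c ?P (laws M s \<Q>))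
      \<le> (\<Sum>Q\<in>laws M s \<Q>. measure P (subpath s -` E Q \<inter> space P))"
    unfolding eq using fin measurable_sets[OF proj E]
    by (intro finite_measure.finite_measure_subadditive_finite) (use pP in \<open>auto simp: prob_space_def\<close>)
  also have "\<dots> \<le> (\<Sum>Q\<in>laws M s \<Q>. 1 / c)"
    by (intro sum_mono each)
  finally show "measure P (crossing M s ?R c ?P (laws M s \<Q>)) \<le> card (laws M s \<Q>) / c"
    by simp
qed

text \<open>
  Under a \<open>P\<close> for which \<open>e\<close> is not a signal, the law of \<open>P\<close> competes in the denominator of the
  isolation statistic, so a large statistic makes some law in the numerator beat it by the factor \<open>c\<close>.
\<close>

lemma iso_stat_ge_imp_crossing:
  assumes "valid_problem M" "G_Psi M e \<noteq> {}" "P \<in> H_Psi M e"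
    and "\<omega> \<in> space (path_space M (sources M))" "1 \<le> n" "ennreal c \<le> iso_stat M sub P0 e n \<omega>"
  shows "\<omega> \<in> crossing M (sub e) (P0 e) c (law M (sub e) P) (laws M (sub e) (G_Psi M e))"
proof -
  let ?\<Lambda> = "\<lambda>Q. lik_ratio M (sub e) n Q (P0 e) (subpath (sub e) \<omega>)"
  let ?G = "laws M (sub e) (G_Psi M e)" and ?H = "laws M (sub e) (H_Psi M e)"
  have "ennreal c * ?\<Lambda> (law M (sub e) P) \<le> ennreal c * Max (?\<Lambda> ` ?H)"
    using assms(3) finite_laws[OF assms(1)]
    by (intro mult_left_mono Max_ge finite_imageI imageI) (auto simp: laws_def)
  also have "\<dots> \<le> Max (?\<Lambda> ` ?G)"
    using assms(6) unfolding iso_stat_def by (rule threshold_le_divide_imp_mult_le)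
  finally have le: "ennreal c * ?\<Lambda> (law M (sub e) P) \<le> Max (?\<Lambda> ` ?G)" .
  have "Max (?\<Lambda> ` ?G) \<in> ?\<Lambda> ` ?G"
    using assms(2) finite_laws[OF assms(1)] by (intro Max_in) (auto simp: laws_def)
  then obtain Q where "Q \<in> ?G" "Max (?\<Lambda> ` ?G) = ?\<Lambda> Q"
    by (rule imageE)
  with le show ?thesis
    using assms(4,5) unfolding crossing_def mem_Collect_eq by metis
qed

text \<open>
  The mirror image: if \<open>e\<close> is a signal under \<open>P\<close>, the law of \<open>P\<close> competes in the numerator.
\<close>

lemma iso_stat_le_imp_crossing:
  assumes "valid_problem M" "H_Psi M e \<noteq> {}" "P \<in> G_Psi M e" "0 < c"
    and "\<omega> \<in> space (path_space M (sources M))" "1 \<le> n" "iso_stat M sub P0 e n \<omega> \<le> ennreal (1 / c)"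
  shows "\<omega> \<in> crossing M (sub e) (P0 e) c (law M (sub e) P) (laws M (sub e) (H_Psi M e))"
proof -
  let ?\<Lambda> = "\<lambda>Q. lik_ratio M (sub e) n Q (P0 e) (subpath (sub e) \<omega>)"
  let ?G = "laws M (sub e) (G_Psi M e)" and ?H = "laws M (sub e) (H_Psi M e)"
  have "ennreal c * ?\<Lambda> (law M (sub e) P) \<le> ennreal c * Max (?\<Lambda> ` ?G)"
    using assms(3) finite_laws[OF assms(1)]
    by (intro mult_left_mono Max_ge finite_imageI imageI) (auto simp: laws_def)
  also have "\<dots> \<le> Max (?\<Lambda> ` ?H)"
    using assms(7,4) unfolding iso_stat_def by (rule divide_le_inverse_threshold_imp_mult_le)
  finally have le: "ennreal c * ?\<Lambda> (law M (sub e) P) \<le> Max (?\<Lambda> ` ?H)" .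
  have "Max (?\<Lambda> ` ?H) \<in> ?\<Lambda> ` ?H"
    using assms(2) finite_laws[OF assms(1)] by (intro Max_in) (auto simp: laws_def)
  then obtain Q where "Q \<in> ?H" "Max (?\<Lambda> ` ?H) = ?\<Lambda> Q"
    by (rule imageE)
  with le show ?thesis
    using assms(5,6) unfolding crossing_def mem_Collect_eq by metis
qed

lemma signals_H_0:
  assumes "valid_problem M" "P \<in> H_0 M"
  shows "signals M P = {}"
  using assms by (auto simp: signals_def H_0_def valid_problem_def) blast

lemma union_bound:
  assumes P: "prob_space P" and "finite U" "I \<subseteq> U" "0 \<le> \<alpha>"
    and C: "\<And>e. e \<in> I \<Longrightarrow> C e \<in> sets P" "\<And>e. e \<in> I \<Longrightarrow> measure P (C e) \<le> \<alpha> / card U"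
    and S: "S \<subseteq> (\<Union>e\<in>I. C e)"
  shows "measure P S \<le> \<alpha>"
proof -
  interpret prob_space P by (rule P)
  have fin: "finite I"
    using assms(2,3) by (rule finite_subset[rotated])
  have "measure P S \<le> measure P (\<Union>e\<in>I. C e)"
    using fin C S by (intro finite_measure_mono sets.finite_UN) auto
  also have "\<dots> \<le> (\<Sum>e\<in>I. measure P (C e))"
    using fin C by (intro finite_measure_subadditive_finite) auto
  also have "\<dots> \<le> (\<Sum>e\<in>I. \<alpha> / card U)"
    by (intro sum_mono C)
  also have "\<dots> = card I * (\<alpha> / card U)"
    by simp
  also have "\<dots> \<le> card U * (\<alpha> / card U)"
    using assms(2-4) by (intro mult_right_mono) (auto intro: card_mono)
  also have "\<dots> \<le> \<alpha>"
    using assms(4) by simp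
  finally show ?thesis .
qed

text \<open>
  The prescribed thresholds exceed \<open>1\<close>. Hence \<open>1\<close> lies inside the continuation interval
  \<open>(1/A, B)\<close>, and on stopping a statistic above \<open>1\<close> must be at least \<open>B\<close>, one that is at most \<open>1\<close>
  must be at most \<open>1/A\<close>.
\<close>

lemma threshold_arith:
  fixes c \<alpha> :: real
  assumes "c \<ge> real k * real K / \<alpha>" "0 < \<alpha>" "\<alpha> < 1" "0 < k" "0 < K"
  shows "1 < c" "real k / c \<le> \<alpha> / real K"
proof -
  have "1 * 1 \<le> real k * real K"
    using assms by (intro mult_mono) auto
  then have "1 < real k * real K / \<alpha>"
    using assms by (simp add: field_simps)
  then show "1 < c" using assms(1) by linarith
  then show "real k / c \<le> \<alpha> / real K"
    using assms by (simp add: field_simps)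
qed

text \<open>
  A false inclusion of \<open>e\<close> forces a crossing of level \<open>B e\<close>, a false exclusion one of level \<open>A e\<close>.
  With the given thresholds each crossing costs at most a share \<open>1 / |K|\<close> of the error level, \<open>|K|\<close>
  being the number of units, and the shares are added up.
\<close>

lemma pure_isolation_test_controlled:
  fixes A B :: "nat set \<Rightarrow> real"
  assumes M: "valid_problem M" and ac: "mutually_ac M"
    and sub: "\<forall>e\<in>units M. e \<subseteq> sub e \<and> sub e \<subseteq> sources M"
    and P0: "\<forall>e\<in>units M. P0 e \<in> laws M (sub e) (H_0 M)"
    and ne: "\<forall>e\<in>units M. G_Psi M e \<noteq> {} \<and> H_Psi M e \<noteq> {}"
    and Psi: "{} \<notin> Psi M"
    and lev: "0 < \<gamma>" "\<gamma> < 1" "0 < \<delta>" "\<delta> < 1"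
    and A: "\<forall>e\<in>units M. A e \<ge> real (card (laws M (sub e) (H_Psi M e))) * real (card (units M)) / \<delta>"
    and B: "\<forall>e\<in>units M. B e \<ge> real (card (laws M (sub e) (G_Psi M e))) * real (card (units M)) / \<gamma>"
  shows "pure_isolation_test M sub P0 A B \<in> controlled_tests M \<gamma> \<delta>"
proof -
  let ?T = "T_star M sub P0 A B" and ?D = "D_star M sub P0 A B"
  note finU = finite_units[OF M]
  have unit: "1 < A e" "1 < B e"
     "card (laws M (sub e) (H_Psi M e)) / A e \<le> \<delta> / card (units M)"
     "card (laws M (sub e) (G_Psi M e)) / B e \<le> \<gamma> / card (units M)" if "e \<in> units M" for e
  proof -
    have "0 < card (units M)"
      using that finU by (auto simp: card_gt_0_iff)
    moreover have "0 < card (laws M (sub e) (H_Psi M e))" "0 < card (laws M (sub e) (G_Psi M e))"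
      using that ne finite_laws[OF M] by (auto simp: card_gt_0_iff laws_def)
    ultimately show "1 < A e" "1 < B e"
     "card (laws M (sub e) (H_Psi M e)) / A e \<le> \<delta> / card (units M)"
     "card (laws M (sub e) (G_Psi M e)) / B e \<le> \<gamma> / card (units M)"
      using threshold_arith[of _ _ \<delta> "A e"] threshold_arith[of _ _ \<gamma> "B e"] that A B lev by auto
  qed
  have fams: "H_0 M \<subseteq> family M" "G_Psi M e \<subseteq> family M" "H_Psi M e \<subseteq> family M" for e
    by (auto simp: H_0_def G_Psi_def H_Psi_def P_Psi_def)
  have acH0: "absolutely_continuous (restr_to_subalg (law M (sub e) R) (filt M (sub e) (enat n)))
                            (restr_to_subalg (law M (sub e) Q) (filt M (sub e) (enat n)))"
    if "e \<in> units M" "R \<in> H_0 M" "Q \<in> G_Psi M e \<union> H_Psi M e" "1 \<le> n" for e R Q n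
    using that(3)
  proof
    have s: "e \<subseteq> sub e \<and> sub e \<subseteq> sources M \<and> 1 \<le> n"
      using that sub by auto
    note pair = ac[unfolded mutually_ac_def, rule_format, OF that(1) _ _ s]
    show ?thesis if "Q \<in> G_Psi M e"
      using pair[of Q R] that \<open>R \<in> H_0 M\<close> by simp
    show ?thesis if "Q \<in> H_Psi M e"
      using pair[of R Q] that \<open>R \<in> H_0 M\<close> by simp
  qed
  have errors: "measure P {\<omega> \<in> space P. ?T \<omega> < \<infinity> \<and> ?D \<omega> - signals M P \<noteq> {}} \<le> \<gamma>
      \<and> measure P {\<omega> \<in> space P. ?T \<omega> < \<infinity> \<and> signals M P - ?D \<omega> \<noteq> {} \<and> ?D \<omega> \<noteq> {}} \<le> \<delta>"
    if P: "P \<in> P_Psi M" for P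
  proof
    have "P \<in> family M"
      using P by (simp add: P_Psi_def)
    note famP = this
    then have prob: "prob_space P" and sP: "sets P = sets (path_space M (sources M))"
      using M by (auto simp: valid_problem_def)
    note spP = sets_eq_imp_space_eq[OF sP]
    \<comment> \<open>Since the empty set is excluded from \<open>Psi\<close>, the global null is excluded as well; otherwise \<open>P\<close>
      would not be among the laws in the denominator of the statistic of a non-signal.\<close>
    have notH0: "P \<notin> H_0 M"
      using P Psi signals_H_0[OF M, of P] by (auto simp: P_Psi_def)
    let ?C\<^sub>H = "\<lambda>e. crossing M (sub e) (P0 e) (B e) (law M (sub e) P) (laws M (sub e) (G_Psi M e))"
    let ?C\<^sub>G = "\<lambda>e. crossing M (sub e) (P0 e) (A e) (law M (sub e) P) (laws M (sub e) (H_Psi M e))"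
    have inH: "P \<in> H_Psi M e" if "e \<in> units M - signals M P" for e
      using that P notH0 by (auto simp: H_Psi_def)
    have inG: "P \<in> G_Psi M e" if "e \<in> signals M P" for e
      using that P by (auto simp: G_Psi_def)
    have C\<^sub>H: "?C\<^sub>H e \<in> sets P" "measure P (?C\<^sub>H e) \<le> \<gamma> / card (units M)"
      if e: "e \<in> units M - signals M P" for e
    proof -
      obtain R where R: "R \<in> H_0 M" "P0 e = law M (sub e) R"
        using P0 e by (auto simp: laws_def)
      have "?C\<^sub>H e \<in> sets P \<and> measure P (?C\<^sub>H e) \<le> card (laws M (sub e) (G_Psi M e)) / B e"
        unfolding R(2) using famP fams e R(1) inH[OF e] unit[of e] sub
        by (intro conjI crossing_bound[OF M] acH0) (auto dest: inH)
      then show "?C\<^sub>H e \<in> sets P" "measure P (?C\<^sub>H e) \<le> \<gamma> / card (units M)"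
        using unit(4)[of e] e by auto
    qed
    have C\<^sub>G: "?C\<^sub>G e \<in> sets P" "measure P (?C\<^sub>G e) \<le> \<delta> / card (units M)"
      if e: "e \<in> signals M P" for e
    proof -
      have eU: "e \<in> units M" using e by (simp add: signals_def)
      obtain R where R: "R \<in> H_0 M" "P0 e = law M (sub e) R"
        using P0 eU by (auto simp: laws_def)
      have "?C\<^sub>G e \<in> sets P \<and> measure P (?C\<^sub>G e) \<le> card (laws M (sub e) (H_Psi M e)) / A e"
        unfolding R(2) using famP fams eU R(1) inG[OF e] unit[of e] sub
        by (intro conjI crossing_bound[OF M] acH0) auto
      then show "?C\<^sub>G e \<in> sets P" "measure P (?C\<^sub>G e) \<le> \<delta> / card (units M)"
        using unit(3)[of e] eU by auto
    qed
    show "measure P {\<omega> \<in> space P. ?T \<omega> < \<infinity> \<and> ?D \<omega> - signals M P \<noteq> {}} \<le> \<gamma>"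
    proof (rule union_bound[OF prob finU])
      show "{\<omega> \<in> space P. ?T \<omega> < \<infinity> \<and> ?D \<omega> - signals M P \<noteq> {}} \<subseteq> (\<Union>e\<in>units M - signals M P. ?C\<^sub>H e)"
      proof
        fix \<omega> assume "\<omega> \<in> {\<omega> \<in> space P. ?T \<omega> < \<infinity> \<and> ?D \<omega> - signals M P \<noteq> {}}"
        then obtain e n where \<omega>: "\<omega> \<in> space P" and T: "?T \<omega> = enat n"
          and e: "e \<in> ?D \<omega>" "e \<notin> signals M P"
          by (cases "?T \<omega>") auto
        have st: "stops_at M sub P0 A B n \<omega>"
          by (rule T_star_attained[OF T])
        have eU: "e \<in> units M" and gt: "1 < iso_stat M sub P0 e n \<omega>"
          using e(1) T by (auto simp: D_star_def D_iso_def)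
        have "ennreal (1 / A e) \<le> ennreal 1"
          using unit(1)[OF eU] by (intro ennreal_leI) simp
        also have "ennreal 1 < iso_stat M sub P0 e n \<omega>"
          using gt by simp
        finally have "ennreal (B e) \<le> iso_stat M sub P0 e n \<omega>"
          using st eU by (auto simp: stops_at_def not_less)
        then have "\<omega> \<in> ?C\<^sub>H e"
          using M ne eU e \<omega> st spP by (intro iso_stat_ge_imp_crossing inH) (auto simp: stops_at_def)
        then show "\<omega> \<in> (\<Union>e\<in>units M - signals M P. ?C\<^sub>H e)"
          using eU e(2) by blast
      qed
    qed (use C\<^sub>H lev in auto)
    show "measure P {\<omega> \<in> space P. ?T \<omega> < \<infinity> \<and> signals M P - ?D \<omega> \<noteq> {} \<and> ?D \<omega> \<noteq> {}} \<le> \<delta>"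
    proof (rule union_bound[OF prob finU])
      show "{\<omega> \<in> space P. ?T \<omega> < \<infinity> \<and> signals M P - ?D \<omega> \<noteq> {} \<and> ?D \<omega> \<noteq> {}} \<subseteq> (\<Union>e\<in>signals M P. ?C\<^sub>G e)"
      proof
        fix \<omega> assume "\<omega> \<in> {\<omega> \<in> space P. ?T \<omega> < \<infinity> \<and> signals M P - ?D \<omega> \<noteq> {} \<and> ?D \<omega> \<noteq> {}}"
        then obtain e n where \<omega>: "\<omega> \<in> space P" and T: "?T \<omega> = enat n"
          and e: "e \<notin> ?D \<omega>" "e \<in> signals M P"
          by (cases "?T \<omega>") auto
        have st: "stops_at M sub P0 A B n \<omega>"
          by (rule T_star_attained[OF T])
        have eU: "e \<in> units M"
          using e(2) by (simp add: signals_def)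
        have le: "iso_stat M sub P0 e n \<omega> \<le> 1"
          using e(1) T eU by (auto simp: D_star_def D_iso_def not_less)
        have "iso_stat M sub P0 e n \<omega> \<le> ennreal 1"
          using le by simp
        also have "ennreal 1 < ennreal (B e)"
          using unit(2)[OF eU] by (intro ennreal_lessI) auto
        finally have "iso_stat M sub P0 e n \<omega> \<le> ennreal (1 / A e)"
          using st eU by (auto simp: stops_at_def not_less)
        then have "\<omega> \<in> ?C\<^sub>G e"
          using M ne eU e \<omega> st spP unit(1)[OF eU]
          by (intro iso_stat_le_imp_crossing inG) (auto simp: stops_at_def)
        then show "\<omega> \<in> (\<Union>e\<in>signals M P. ?C\<^sub>G e)"
          using e(2) by blast
      qed
    qed (use C\<^sub>G lev in \<open>auto simp: signals_def\<close>)
  qed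
  have "pure_isolation_test M sub P0 A B \<in> tests M"
    using M sub P0 by (intro pure_isolation_test_in_tests) auto
  then show ?thesis
    using errors by (auto simp: controlled_tests_def pure_isolation_test_def)
qed

theorem theorem3p1:
  fixes M :: "'x testing_problem"
    and sub :: "nat set \<Rightarrow> nat set"
    and P0 :: "nat set \<Rightarrow> (nat \<times> nat \<Rightarrow> 'x) measure"
    and A B :: "nat set \<Rightarrow> real"
    and a b :: "nat set \<Rightarrow> nat"
    and \<gamma> \<delta> :: real
  assumes "valid_problem M"
    and "mutually_ac M"
    and "\<forall>e\<in>units M. e \<subseteq> sub e \<and> sub e \<subseteq> sources M"
    and "\<forall>e\<in>units M. P0 e \<in> laws M (sub e) (H_0 M)"
    and "\<forall>e\<in>units M. G_Psi M e \<noteq> {} \<and> H_Psi M e \<noteq> {}"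
    and "{} \<notin> Psi M"
    and "0 < \<gamma>" "\<gamma> < 1" "0 < \<delta>" "\<delta> < 1"
    and "\<forall>e\<in>units M. a e = card (laws M (sub e) (H_Psi M e))"
    and "\<forall>e\<in>units M. b e = card (laws M (sub e) (G_Psi M e))"
  shows
    "((\<forall>e\<in>units M. A e \<ge> real (a e) * real (card (units M)) / \<delta> \<and>
                    B e \<ge> real (b e) * real (card (units M)) / \<gamma>)
        \<longrightarrow> pure_isolation_test M sub P0 A B \<in> controlled_tests M \<gamma> \<delta>) \<and>
     (\<forall>m::nat. 0 < m \<and> m < card (units M) \<and> Psi M = {S. S \<subseteq> units M \<and> card S = m} \<and>
        (\<forall>e\<in>units M. A e \<ge> real (a e) * real (card (units M)) / min \<gamma> \<delta> \<and>
                      B e \<ge> real (b e) * real (card (units M)) / min \<gamma> \<delta>)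
        \<longrightarrow> pure_isolation_test M sub P0 A B \<in> controlled_tests M \<gamma> \<delta>)"
proof -
  have main: "pure_isolation_test M sub P0 A B \<in> controlled_tests M \<gamma> \<delta>"
    if "\<forall>e\<in>units M. A e \<ge> real (a e) * real (card (units M)) / \<delta> \<and>
                    B e \<ge> real (b e) * real (card (units M)) / \<gamma>"
    using that assms by (intro pure_isolation_test_controlled) auto
  have weaken: "real k * real (card (units M)) / \<alpha> \<le> c"
    if "real k * real (card (units M)) / min \<gamma> \<delta> \<le> c" "\<alpha> \<in> {\<gamma>, \<delta>}" for k c \<alpha>
  proof -
    have "real k * real (card (units M)) / \<alpha> \<le> real k * real (card (units M)) / min \<gamma> \<delta>"
      using that(2) assms(7,9) by (intro divide_left_mono) auto
    then show ?thesis using that(1) by simp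
  qed
  show ?thesis
    using main weaken by blast
qed

end
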